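(* Let $\mathcal{M}=\mathcal{SE}_2(3)\times\mathbb{R}^9$ with elements $\xi=(\mathbf{T},\boldsymbol{b})$, and let $\mathbf{G_{TG}}=\mathbf{SE}_2(3)\ltimes\mathfrak{se}_2(3)$ with elements $X=(D,\delta)$, $D\in\mathbf{SE}_2(3)$, $\delta\in\mathfrak{se}_2(3)$. Define $\phi:\mathbf{G_{TG}}\times\mathcal{M}\to\mathcal{M}$ by $$\phi(X,\xi):=\big(\mathbf{T}D,\;\mathbf{Ad}^{\vee}_{D^{-1}}(\boldsymbol{b}-\delta^{\vee})\big).$$ Then $\phi$ is a transitive right group action of $\mathbf{G_{TG}}$ on $\mathcal{M}$.
   Context: $\mathbf{SE}_2(3)$ is the matrix Lie group of $5\times5$ matrices $\begin{bmatrix}A&\boldsymbol{a}&\boldsymbol{b}\\0&1&0\\0&0&1\end{bmatrix}$ with $A\in\mathbf{SO}(3)$, $\boldsymbol{a},\boldsymbol{b}\in\mathbb{R}^3$; $\mathcal{SE}_2(3)$ is its underlying smooth manifold (without group structure). Its Lie algebra $\mathfrak{se}_2(3)$ consists of the matrices $(\boldsymbol{\omega},\boldsymbol{v},\boldsymbol{w})^{\wedge}=\begin{bmatrix}\boldsymbol{\omega}^{\wedge}&\boldsymbol{v}&\boldsymbol{w}\\0&0&0\\0&0&0\end{bmatrix}$ for $\boldsymbol{\omega},\boldsymbol{v},\boldsymbol{w}\in\mathbb{R}^3$, where $\boldsymbol{\omega}^{\wedge}$ is the $3\times3$ skew-symmetric cross-product matrix; $(\cdot)^{\vee}:\mathfrak{se}_2(3)\to\mathbb{R}^9$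 is the inverse of $(\cdot)^{\wedge}$. $\mathrm{Ad}_D[\eta]=D\eta D^{-1}$, and $\mathbf{Ad}^{\vee}_D\boldsymbol{u}=(\mathrm{Ad}_D[\boldsymbol{u}^{\wedge}])^{\vee}$ for $\boldsymbol{u}\in\mathbb{R}^9$. The group product in $\mathbf{G_{TG}}$ is $XY=(D_XD_Y,\;\delta_X+\mathrm{Ad}_{D_X}[\delta_Y])$, with inverse $X^{-1}=(D^{-1},-\mathrm{Ad}_{D^{-1}}[\delta])$. A right group action is a smooth map with $\phi(I,\xi)=\xi$ and $\phi(X,\phi(Y,\xi))=\phi(YX,\xi)$; it is transitive if for all $\xi_1,\xi_2\in\mathcal{M}$ there is $Z$ with $\phi(Z,\xi_1)=\xi_2$. *)

theory Defs
  imports "HOL-Analysis.Analysis" "HOL-Algebra.Group"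
begin

subsection \<open>Smooth maps between subsets of Euclidean spaces\<close>

text \<open>All manifolds below are embedded submanifolds of Euclidean spaces. A map between such
  submanifolds is smooth iff it is locally the restriction of a \<open>C\<^sup>\<infinity>\<close> map defined on an
  open subset of the ambient space. On an open set, \<open>Ck_on k\<close> is the usual notion of a
  \<open>k\<close> times continuously differentiable map, expressed by iterated directional derivatives.\<close>

primrec Ck_on :: "nat \<Rightarrow> ('a::euclidean_space \<Rightarrow> 'b::euclidean_space) \<Rightarrow> 'a set \<Rightarrow> bool" where
  "Ck_on 0 f U \<longleftrightarrow> continuous_on U f"
| "Ck_on (Suc k) f U \<longleftrightarrow>
     (\<forall>x\<in>U. f differentiable (at x)) \<and> (\<forall>v. Ck_on k (\<lambda>x. frechet_derivative f (at x) v) U)"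

definition smooth_map :: "'a::euclidean_space set \<Rightarrow> 'b::euclidean_space set \<Rightarrow> ('a \<Rightarrow> 'b) \<Rightarrow> bool" where
  "smooth_map S T f \<longleftrightarrow> f ` S \<subseteq> T \<and>
     (\<forall>x\<in>S. \<exists>U F. open U \<and> x \<in> U \<and> (\<forall>k. Ck_on k F U) \<and> (\<forall>y\<in>S \<inter> U. F y = f y))"

subsection \<open>Right group actions\<close>

definition right_group_action ::
    "'g::euclidean_space monoid \<Rightarrow> 'm::euclidean_space set \<Rightarrow> ('g \<times> 'm \<Rightarrow> 'm) \<Rightarrow> bool" where
  "right_group_action G M f \<longleftrightarrow>
     group G \<and>
     smooth_map (carrier G \<times> M) M f \<and>
     (\<forall>p\<in>M. f (\<one>\<^bsub>G\<^esub>, p) = p) \<and>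
     (\<forall>x\<in>carrier G. \<forall>y\<in>carrier G. \<forall>p\<in>M. f (x, f (y, p)) = f (y \<otimes>\<^bsub>G\<^esub> x, p))"

definition transitive_action ::
    "'g::euclidean_space monoid \<Rightarrow> 'm::euclidean_space set \<Rightarrow> ('g \<times> 'm \<Rightarrow> 'm) \<Rightarrow> bool" where
  "transitive_action G M f \<longleftrightarrow> (\<forall>p\<in>M. \<forall>q\<in>M. \<exists>z\<in>carrier G. f (z, p) = q)"

subsection \<open>The extended special Euclidean group and its Lie algebra\<close>

text \<open>The block matrix with rows \<open>(A, a, b)\<close>, \<open>(0, c, 0)\<close>, \<open>(0, 0, c)\<close>.\<close>

definition block :: "real^3^3 \<Rightarrow> real^3 \<Rightarrow> real^3 \<Rightarrow> real \<Rightarrow> real^5^5" where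
  "block A a b c = vector
     [vector [A$1$1, A$1$2, A$1$3, a$1, b$1],
      vector [A$2$1, A$2$2, A$2$3, a$2, b$2],
      vector [A$3$1, A$3$2, A$3$3, a$3, b$3],
      vector [0, 0, 0, c, 0],
      vector [0, 0, 0, 0, c]]"

definition SE23 :: "(real^5^5) set" where
  "SE23 = {block A a b 1 | A a b. rotation_matrix A}"

definition skew3 :: "real^3 \<Rightarrow> real^3^3" where
  "skew3 w = vector
     [vector [0, - w$3, w$2],
      vector [w$3, 0, - w$1],
      vector [- w$2, w$1, 0]]"

definition se23 :: "(real^5^5) set" where
  "se23 = {block (skew3 \<omega>) v w 0 | \<omega> v w. True}"

text \<open>A vector of \<open>\<real>\<^sup>9\<close> is the concatenation of \<open>\<omega>\<close>, \<open>v\<close> and \<open>w\<close>.\<close>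

definition wedge :: "real^9 \<Rightarrow> real^5^5" where
  "wedge u = block (skew3 (vector [u$1, u$2, u$3])) (vector [u$4, u$5, u$6]) (vector [u$7, u$8, u$9]) 0"

definition vee :: "real^5^5 \<Rightarrow> real^9" where
  "vee = the_inv_into UNIV wedge"

definition Ad :: "real^5^5 \<Rightarrow> real^5^5 \<Rightarrow> real^5^5" where
  "Ad D \<eta> = D ** \<eta> ** matrix_inv D"

definition Ad_vee :: "real^5^5 \<Rightarrow> real^9 \<Rightarrow> real^9" where
  "Ad_vee D u = vee (Ad D (wedge u))"

subsection \<open>The tangent group, the state space and the map\<close>

definition TG :: "((real^5^5) \<times> (real^5^5)) monoid" where
  "TG = \<lparr>carrier = SE23 \<times> se23,
         mult = (\<lambda>(D\<^sub>X, \<delta>\<^sub>X) (D\<^sub>Y, \<delta>\<^sub>Y). (D\<^sub>X ** D\<^sub>Y, \<delta>\<^sub>X + Ad D\<^sub>X \<delta>\<^sub>Y)),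
         one = (mat 1, 0)\<rparr>"

definition state_space :: "((real^5^5) \<times> (real^9)) set" where
  "state_space = SE23 \<times> UNIV"

definition phi :: "((real^5^5) \<times> (real^5^5)) \<times> ((real^5^5) \<times> (real^9)) \<Rightarrow> (real^5^5) \<times> (real^9)" where
  "phi = (\<lambda>((D, \<delta>), (T, b)). (T ** D, Ad_vee (matrix_inv D) (b - vee \<delta>)))"

end

theory Submission
  imports Defs
begin

text \<open>Since \<open>Ad\<close> is a linear action of \<open>SE23\<close> on \<open>se23\<close>, the action law reduces to
  \<open>Ad (inverse E) (b - \<epsilon> - Ad E \<delta>) = Ad (inverse E) (b - \<epsilon>) - \<delta>\<close>, and transitivity to solving
  \<open>T D = T'\<close> for \<open>D\<close> and then \<open>b - \<delta> = Ad D b'\<close> for \<open>\<delta>\<close>. For smoothness, the map is shown to be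
  the restriction of one built from linear and bilinear maps on the ambient Euclidean space.\<close>

section \<open>Maps of class $C^k$\<close>

text \<open>Openness of \<open>U\<close> is what makes this work: near a point of \<open>U\<close>
  the two functions coincide, so their derivatives there coincide as well.\<close>

lemma Ck_on_cong:
  assumes "open U" "\<And>x. x \<in> U \<Longrightarrow> f x = g x" "Ck_on k f U"
  shows "Ck_on k g U"
  using assms(2,3)
proof (induction k arbitrary: f g)
  case 0
  then show ?case
    by (simp cong: continuous_on_cong)
next
  case (Suc k)
  have der: "(g has_derivative frechet_derivative f (at x)) (at x)" if "x \<in> U" for x
    using has_derivative_transform_within_open[of f _ x UNIV U g] Suc.prems that \<open>open U\<close>
    by (simp add: frechet_derivative_works)
  have eq: "frechet_derivative f (at x) = frechet_derivative g (at x)" if "x \<in> U" for x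
    using der[OF that] by (rule frechet_derivative_at)
  have "Ck_on k (\<lambda>x. frechet_derivative g (at x) v) U" for v
    using Suc.IH[of "\<lambda>x. frechet_derivative f (at x) v" "\<lambda>x. frechet_derivative g (at x) v"] Suc.prems(2) eq by simp
  then show ?case
    using der by (auto simp: differentiable_def)
qed

text \<open>Derivatives at a point are unique, so any explicit formula \<open>f'\<close> can stand
  in for the chosen \<open>frechet_derivative\<close>. The later closure rules all rest on
  this.\<close>

lemma Ck_on_SucI:
  assumes "open U" "\<And>x. x \<in> U \<Longrightarrow> (f has_derivative f' x) (at x)"
    and "\<And>v. Ck_on k (\<lambda>x. f' x v) U"
  shows "Ck_on (Suc k) f U"
proof -
  have eq: "f' x = frechet_derivative f (at x)" if "x \<in> U" for x
    using assms(2)[OF that] by (rule frechet_derivative_at)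
  have "Ck_on k (\<lambda>x. frechet_derivative f (at x) v) U" for v
    by (rule Ck_on_cong[OF assms(1) _ assms(3)[of v]]) (simp add: eq)
  then show ?thesis
    using assms(2) by (auto simp: differentiable_def)
qed

lemma Ck_on_SucD: "Ck_on (Suc k) f U \<Longrightarrow> Ck_on k f U"
proof (induction k arbitrary: f)
  case 0
  then show ?case
    by (auto intro!: continuous_at_imp_continuous_on differentiable_imp_continuous_within)
next
  case (Suc k)
  then show ?case
    by (metis Ck_on.simps(2))
qed

lemma Ck_on_derivative:
  assumes "Ck_on (Suc k) f U" "x \<in> U"
  shows "(f has_derivative frechet_derivative f (at x)) (at x)"
  using assms by (simp add: frechet_derivative_works)

lemma Ck_on_const: "open U \<Longrightarrow> Ck_on k (\<lambda>x. c) U"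
proof (induction k arbitrary: c)
  case (Suc k)
  show ?case
    by (rule Ck_on_SucI[where f' = "\<lambda>x v. 0"]) (use Suc in auto)
qed simp

text \<open>The derivative is \<open>f\<close> itself at every point, so each directional derivative
  is constant.\<close>

lemma Ck_on_linear:
  assumes "open U" "linear f"
  shows "Ck_on k f U"
proof (cases k)
  case 0
  then show ?thesis
    using assms by (simp add: linear_continuous_on linear_linear)
next
  case (Suc m)
  have "(f has_derivative f) (at x)" for x
    using assms(2) by (simp add: linear_imp_has_derivative)
  then show ?thesis
    unfolding Suc using assms(1) by (intro Ck_on_SucI[where f' = "\<lambda>x. f"] Ck_on_const)
qed

lemma Ck_on_linear_compose:
  assumes "open U" "linear g" "Ck_on k f U"
  shows "Ck_on k (\<lambda>x. g (f x)) U"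
  using assms(3)
proof (induction k arbitrary: f)
  case 0
  then show ?case
    using assms(2) linear_continuous_on_compose[of U f g] by simp
next
  case (Suc k)
  have g: "bounded_linear g"
    using assms(2) by (simp add: linear_linear)
  show ?case
  proof (rule Ck_on_SucI[OF assms(1)])
    show "((\<lambda>x. g (f x)) has_derivative (\<lambda>v. g (frechet_derivative f (at x) v))) (at x)"
      if "x \<in> U" for x
      using bounded_linear.has_derivative[OF g Ck_on_derivative[OF Suc.prems that]] .
    show "Ck_on k (\<lambda>x. g (frechet_derivative f (at x) v)) U" for v
      using Suc by simp
  qed
qed

lemma Ck_on_add:
  assumes "open U" "Ck_on k f U" "Ck_on k g U"
  shows "Ck_on k (\<lambda>x. f x + g x) U"
  using assms(2,3)
proof (induction k arbitrary: f g)
  case 0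
  then show ?case
    by (simp add: continuous_on_add)
next
  case (Suc k)
  show ?case
  proof (rule Ck_on_SucI[OF assms(1)])
    show "((\<lambda>x. f x + g x) has_derivative
        (\<lambda>v. frechet_derivative f (at x) v + frechet_derivative g (at x) v)) (at x)"
      if "x \<in> U" for x
      using Suc.prems that by (intro has_derivative_add Ck_on_derivative)
    show "Ck_on k (\<lambda>x. frechet_derivative f (at x) v + frechet_derivative g (at x) v) U" for v
      using Suc by simp
  qed
qed

text \<open>A pair is the sum of its images under the two linear coordinate injections, which
  reduces the claim to sums and linear maps.\<close>

lemma Ck_on_Pair:
  assumes "open U" "Ck_on k f U" "Ck_on k g U"
  shows "Ck_on k (\<lambda>x. (f x, g x)) U"
proof -
  have "linear (\<lambda>a. (a, 0))" "linear (\<lambda>b. (0, b))"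
    by (auto intro!: linearI)
  then have "Ck_on k (\<lambda>x. (f x, 0) + (0, g x)) U"
    by (intro Ck_on_add Ck_on_linear_compose[of U "\<lambda>a. (a, 0)" k f]
        Ck_on_linear_compose[of U "\<lambda>b. (0, b)" k g] assms)
  then show ?thesis
    by simp
qed

text \<open>By the product rule, a directional derivative is again a sum of values of
  \<open>h\<close>, so the induction has to vary both \<open>f\<close> and \<open>g\<close>.\<close>

lemma Ck_on_bilinear:
  fixes h :: "'b::euclidean_space \<Rightarrow> 'c::euclidean_space \<Rightarrow> 'd::euclidean_space"
  assumes "open U" "bilinear h" "Ck_on k f U" "Ck_on k g U"
  shows "Ck_on k (\<lambda>x. h (f x) (g x)) U"
  using assms(3,4)
proof (induction k arbitrary: f g)
  case 0
  have "bounded_bilinear h"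
    using assms(2) by (simp add: bilinear_conv_bounded_bilinear)
  with 0 show ?case
    by (auto intro: bounded_bilinear.continuous_on)
next
  case (Suc k)
  have h: "bounded_bilinear h"
    using assms(2) by (simp add: bilinear_conv_bounded_bilinear)
  show ?case
  proof (rule Ck_on_SucI[OF assms(1)])
    show "((\<lambda>x. h (f x) (g x)) has_derivative
        (\<lambda>v. h (f x) (frechet_derivative g (at x) v) + h (frechet_derivative f (at x) v) (g x))) (at x)"
      if "x \<in> U" for x
      using Suc.prems that by (intro bounded_bilinear.FDERIV[OF h] Ck_on_derivative)
    show "Ck_on k (\<lambda>x. h (f x) (frechet_derivative g (at x) v) + h (frechet_derivative f (at x) v) (g x)) U" for v
      \<comment> \<open>The undifferentiated factors are given at level \<open>Suc k\<close>;
        \<open>Ck_on_SucD\<close> lowers them to level \<open>k\<close>.\<close>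
      using Suc.prems Suc.prems[THEN Ck_on_SucD] by (intro Ck_on_add assms(1) Suc.IH) simp_all
  qed
qed


section \<open>Matrices\<close>

lemma bilinear_matrix_mult: "bilinear ((**) :: real^'n^'m \<Rightarrow> real^'p^'n \<Rightarrow> real^'p^'m)"
  unfolding bilinear_def
  by (auto intro!: linearI simp: vec_eq_iff matrix_matrix_mult_def algebra_simps
      sum.distrib sum_distrib_left)

lemma linear_transpose: "linear (transpose :: real^'n^'m \<Rightarrow> real^'m^'n)"
  by (auto intro!: linearI simp: vec_eq_iff transpose_def)

text \<open>A one-sided inverse of a square matrix is two-sided. This gives the choice in
  \<open>matrix_inv\<close> a witness, and associativity then forces the chosen matrix to be
  \<open>B\<close>.\<close>

lemma matrix_inv_eqI:
  fixes A B :: "real^'n^'n"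
  assumes "A ** B = mat 1"
  shows "matrix_inv A = B"
proof -
  have BA: "B ** A = mat 1"
    using assms by (simp add: matrix_left_right_inverse)
  have inv: "A ** matrix_inv A = mat 1 \<and> matrix_inv A ** A = mat 1"
    unfolding matrix_inv_def by (rule someI[of _ B]) (simp add: assms BA)
  have "matrix_inv A = (B ** A) ** matrix_inv A"
    by (simp add: BA)
  also have "\<dots> = B ** (A ** matrix_inv A)"
    by (rule matrix_mul_assoc[symmetric])
  finally show ?thesis
    by (simp add: inv)
qed

section \<open>Coordinates in dimensions five and nine\<close>

lemma exhaust_5:
  fixes x :: 5
  shows "x = 1 \<or> x = 2 \<or> x = 3 \<or> x = 4 \<or> x = 5"
proof (induct x)
  case (of_int z)
  \<comment> \<open>The representative 0 yields the last alternative, because the numeral 5 equals 0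
    in the type \<open>5\<close>.\<close>
  then have "z = 0 \<or> z = 1 \<or> z = 2 \<or> z = 3 \<or> z = 4" by fastforce
  then show ?case by auto
qed

lemma forall_5: "(\<forall>i::5. P i) \<longleftrightarrow> P 1 \<and> P 2 \<and> P 3 \<and> P 4 \<and> P 5"
  (is "?L \<longleftrightarrow> ?R")
proof
  assume ?R
  show ?L
  proof
    fix i
    from exhaust_5[of i] show "P i"
      using \<open>?R\<close> by (elim disjE) simp_all
  qed
qed simp

lemma UNIV_5: "UNIV = {1, 2, 3, 4, 5::5}"
  using exhaust_5 by blast

lemma sum_5: "sum f (UNIV::5 set) = f 1 + f 2 + f 3 + f 4 + f 5"
  unfolding UNIV_5 by (simp add: add.assoc)

lemma vector_5 [simp]:
  "(vector [a, b, c, d, e] :: ('a::zero)^5)$1 = a"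
  "(vector [a, b, c, d, e] :: ('a::zero)^5)$2 = b"
  "(vector [a, b, c, d, e] :: ('a::zero)^5)$3 = c"
  "(vector [a, b, c, d, e] :: ('a::zero)^5)$4 = d"
  "(vector [a, b, c, d, e] :: ('a::zero)^5)$5 = e"
  unfolding vector_def by simp_all

lemma exhaust_9:
  fixes x :: 9
  shows "x = 1 \<or> x = 2 \<or> x = 3 \<or> x = 4 \<or> x = 5 \<or> x = 6 \<or> x = 7 \<or> x = 8 \<or> x = 9"
proof (induct x)
  case (of_int z)
  then have "0 \<le> z" "z < 9" by simp_all
  then have "z = 0 \<or> z = 1 \<or> z = 2 \<or> z = 3 \<or> z = 4 \<or> z = 5 \<or> z = 6 \<or> z = 7 \<or> z = 8"
    by presburger
  then show ?case by (elim disjE) (hypsubst, simp)+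
qed

lemma forall_9:
  "(\<forall>i::9. P i) \<longleftrightarrow> P 1 \<and> P 2 \<and> P 3 \<and> P 4 \<and> P 5 \<and> P 6 \<and> P 7 \<and> P 8 \<and> P 9"
  (is "?L \<longleftrightarrow> ?R")
proof
  assume ?R
  show ?L
  proof
    fix i
    from exhaust_9[of i] show "P i"
      using \<open>?R\<close> by (elim disjE) simp_all
  qed
qed simp

lemma vector_9 [simp]:
  "(vector [a, b, c, d, e, f, g, h, i] :: ('a::zero)^9)$1 = a"
  "(vector [a, b, c, d, e, f, g, h, i] :: ('a::zero)^9)$2 = b"
  "(vector [a, b, c, d, e, f, g, h, i] :: ('a::zero)^9)$3 = c"
  "(vector [a, b, c, d, e, f, g, h, i] :: ('a::zero)^9)$4 = d"
  "(vector [a, b, c, d, e, f, g, h, i] :: ('a::zero)^9)$5 = e"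
  "(vector [a, b, c, d, e, f, g, h, i] :: ('a::zero)^9)$6 = f"
  "(vector [a, b, c, d, e, f, g, h, i] :: ('a::zero)^9)$7 = g"
  "(vector [a, b, c, d, e, f, g, h, i] :: ('a::zero)^9)$8 = h"
  "(vector [a, b, c, d, e, f, g, h, i] :: ('a::zero)^9)$9 = i"
  unfolding vector_def by simp_all


section \<open>The group and its Lie algebra\<close>

text \<open>Keeping the corner entry general covers products of group elements (corner 1), of
  algebra elements (corner 0) and mixed ones.\<close>

lemma block_mult:
  "block A a b c ** block A' a' b' c' =
    block (A ** A') (A *v a' + c' *\<^sub>R a) (A *v b' + c' *\<^sub>R b) (c * c')"
  by (simp add: vec_eq_iff forall_5 sum_5 sum_3 block_def matrix_matrix_mult_def
      matrix_vector_mult_def algebra_simps)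

lemma mat_1_eq_block: "mat 1 = block (mat 1) 0 0 1"
  by (simp add: vec_eq_iff forall_5 block_def mat_def)

section \<open>Closure of rotations and of \<open>SE23\<close> under products and inverses\<close>

lemma rotation_matrix_mult:
  fixes A B :: "real^'n^'n"
  shows "rotation_matrix A \<Longrightarrow> rotation_matrix B \<Longrightarrow> rotation_matrix (A ** B)"
  by (auto simp: rotation_matrix_def det_mul intro: orthogonal_matrix_mul)

lemma rotation_matrix_transpose: "rotation_matrix A \<Longrightarrow> rotation_matrix (transpose A)"
  by (simp add: rotation_matrix_def)

lemma rotation_matrix_mat_1: "rotation_matrix (mat 1)"
  by (simp add: rotation_matrix_def orthogonal_matrix_id)

lemma rotation_matrix_right_inv: "rotation_matrix A \<Longrightarrow> A ** transpose A = mat 1"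
  by (simp add: rotation_matrix_def orthogonal_matrix_def)

text \<open>Here \<open>x v* A\<close> is the form into which simplification puts
  \<open>transpose A *v x\<close>.\<close>

lemma rotation_matrix_mult_vector_transpose: "rotation_matrix A \<Longrightarrow> A *v (x v* A) = x"
  using matrix_vector_mul_assoc[of A "transpose A" x] by (simp add: rotation_matrix_right_inv)

lemma mat_1_in_SE23: "mat 1 \<in> SE23"
  unfolding SE23_def using mat_1_eq_block rotation_matrix_mat_1 by blast

lemma SE23_mult: "D \<in> SE23 \<Longrightarrow> E \<in> SE23 \<Longrightarrow> D ** E \<in> SE23"
  by (force simp: SE23_def block_mult intro: rotation_matrix_mult)

lemma block_inverse:
  assumes "rotation_matrix A"
  shows "matrix_inv (block A a b 1) = block (transpose A) (- (transpose A *v a)) (- (transpose A *v b)) 1"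
proof (rule matrix_inv_eqI)
  show "block A a b 1 ** block (transpose A) (- (transpose A *v a)) (- (transpose A *v b)) 1 = mat 1"
    using assms by (simp add: block_mult mat_1_eq_block linear_neg rotation_matrix_right_inv
        rotation_matrix_mult_vector_transpose)
qed

lemma SE23_inv: "D \<in> SE23 \<Longrightarrow> matrix_inv D \<in> SE23"
  by (auto simp: SE23_def block_inverse) (metis rotation_matrix_transpose)

lemma SE23_right_inv: "D \<in> SE23 \<Longrightarrow> D ** matrix_inv D = mat 1"
  by (auto simp: SE23_def block_inverse block_mult mat_1_eq_block linear_neg
      rotation_matrix_right_inv rotation_matrix_mult_vector_transpose)

lemma SE23_left_inv: "D \<in> SE23 \<Longrightarrow> matrix_inv D ** D = mat 1"
  using SE23_right_inv matrix_left_right_inverse by blast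

lemma SE23_inv_inv: "D \<in> SE23 \<Longrightarrow> matrix_inv (matrix_inv D) = D"
  by (simp add: SE23_left_inv matrix_inv_eqI)

lemma SE23_inv_mult:
  assumes "D \<in> SE23" "E \<in> SE23"
  shows "matrix_inv (D ** E) = matrix_inv E ** matrix_inv D"
proof (rule matrix_inv_eqI)
  have "(D ** E) ** (matrix_inv E ** matrix_inv D) = D ** (E ** matrix_inv E) ** matrix_inv D"
    by (simp add: matrix_mul_assoc)
  then show "(D ** E) ** (matrix_inv E ** matrix_inv D) = mat 1"
    using assms by (simp add: SE23_right_inv)
qed

section \<open>The adjoint map on \<open>se23\<close>\<close>

lemma skew3_mult_vector: "skew3 w *v x = cross3 w x"
  by (simp add: vec_eq_iff forall_3 skew3_def matrix_vector_mult_def sum_3 cross3_def)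

text \<open>Rotations preserve the cross product: applying \<open>A\<close> to the product of
  \<open>w\<close> and \<open>transpose A *v x\<close> gives the product of \<open>A *v w\<close>
  and \<open>x\<close>.\<close>

lemma skew3_conjugate:
  assumes "rotation_matrix A"
  shows "A ** skew3 w ** transpose A = skew3 (A *v w)"
proof -
  have "(A ** skew3 w ** transpose A) *v x = A *v cross3 w (x v* A)" for x
    by (simp add: skew3_mult_vector flip: matrix_vector_mul_assoc)
  also have "A *v cross3 w (x v* A) = skew3 (A *v w) *v x" for x
    using cross_rotation_matrix[OF assms, of w "x v* A"] assms
    by (simp add: skew3_mult_vector rotation_matrix_mult_vector_transpose)
  finally show ?thesis
    by (simp add: matrix_eq)
qed

text \<open>Invariance of \<open>se23\<close> only needs the rotational block to stay skew, so the
  translational columns are left existential.\<close>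

lemma Ad_block:
  assumes "rotation_matrix A"
  shows "\<exists>v' w'. Ad (block A a b 1) (block (skew3 \<omega>) v w 0) = block (skew3 (A *v \<omega>)) v' w' 0"
  using assms by (auto simp: Ad_def block_inverse block_mult skew3_conjugate)

lemma Ad_in_se23: "D \<in> SE23 \<Longrightarrow> \<eta> \<in> se23 \<Longrightarrow> Ad D \<eta> \<in> se23"
  unfolding SE23_def se23_def using Ad_block by fast

lemma linear_Ad: "linear (Ad D)"
  using linear_compose[of "\<lambda>x. D ** x" "\<lambda>x. x ** matrix_inv D"] bilinear_matrix_mult
  unfolding Ad_def[abs_def] bilinear_def comp_def by blast

lemma Ad_mult: "D \<in> SE23 \<Longrightarrow> E \<in> SE23 \<Longrightarrow> Ad (D ** E) \<eta> = Ad D (Ad E \<eta>)"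
  by (simp add: Ad_def SE23_inv_mult matrix_mul_assoc)

lemma Ad_mat_1: "Ad (mat 1) \<eta> = \<eta>"
  by (simp add: Ad_def matrix_inv_eqI)

section \<open>Coordinates on the Lie algebra and the adjoint map on vectors\<close>

text \<open>\<open>vee\<close> is unspecified outside \<open>se23\<close>; this is its linear extension to all matrices.\<close>

definition vee_lin :: "real^5^5 \<Rightarrow> real^9" where
  "vee_lin \<eta> = vector [\<eta>$3$2, \<eta>$1$3, \<eta>$2$1, \<eta>$1$4, \<eta>$2$4, \<eta>$3$4, \<eta>$1$5, \<eta>$2$5, \<eta>$3$5]"

lemma vee_lin_wedge: "vee_lin (wedge u) = u"
  by (simp add: vee_lin_def wedge_def block_def skew3_def vec_eq_iff forall_9)

lemma linear_vee_lin: "linear vee_lin"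
  by (rule linearI) (simp_all add: vee_lin_def vec_eq_iff forall_9)

lemma linear_wedge: "linear wedge"
  by (rule linearI) (simp_all add: wedge_def block_def skew3_def vec_eq_iff forall_5)

text \<open>The left inverse \<open>vee_lin\<close> shows that \<open>wedge\<close> is injective,
  which the inverse defining \<open>vee\<close> requires.\<close>

lemma vee_wedge: "vee (wedge u) = u"
  unfolding vee_def by (rule the_inv_into_f_f) (auto intro: inj_on_inverseI[of _ vee_lin] simp: vee_lin_wedge)

text \<open>As the range of a linear map, \<open>se23\<close> inherits its closure under addition
  and negation.\<close>

lemma se23_eq_range_wedge: "se23 = range wedge"
proof -
  have eq: "block (skew3 \<omega>) v w 0 =
      wedge (vector [\<omega>$1, \<omega>$2, \<omega>$3, v$1, v$2, v$3, w$1, w$2, w$3])" for \<omega> v w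
    by (simp add: wedge_def block_def skew3_def)
  show ?thesis
  proof
    show "se23 \<subseteq> range wedge"
      unfolding se23_def by (clarify, subst eq) (rule rangeI)
    show "range wedge \<subseteq> se23"
      by (auto simp: se23_def wedge_def)
  qed
qed

lemma vee_eq_vee_lin: "\<eta> \<in> se23 \<Longrightarrow> vee \<eta> = vee_lin \<eta>"
  by (auto simp: se23_eq_range_wedge vee_wedge vee_lin_wedge)

lemma wedge_vee: "\<eta> \<in> se23 \<Longrightarrow> wedge (vee \<eta>) = \<eta>"
  by (auto simp: se23_eq_range_wedge vee_wedge)

lemma wedge_in_se23: "wedge u \<in> se23"
  by (simp add: se23_eq_range_wedge)

lemma wedge_Ad_vee: "D \<in> SE23 \<Longrightarrow> wedge (Ad_vee D u) = Ad D (wedge u)"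
  by (simp add: Ad_vee_def wedge_vee Ad_in_se23 wedge_in_se23)

text \<open>\<open>Ad D\<close> keeps the range of \<open>wedge\<close> inside \<open>se23\<close>,
  where \<open>vee\<close> agrees with \<open>vee_lin\<close>; hence \<open>Ad_vee D\<close> is a
  composition of linear maps.\<close>

lemma linear_Ad_vee:
  assumes "D \<in> SE23"
  shows "linear (Ad_vee D)"
proof -
  have "Ad_vee D = vee_lin \<circ> Ad D \<circ> wedge"
    using assms by (simp add: fun_eq_iff Ad_vee_def vee_eq_vee_lin Ad_in_se23 wedge_in_se23)
  then show ?thesis
    by (simp add: linear_compose linear_wedge linear_Ad linear_vee_lin)
qed

lemma Ad_vee_mult:
  "D \<in> SE23 \<Longrightarrow> E \<in> SE23 \<Longrightarrow> Ad_vee (D ** E) u = Ad_vee D (Ad_vee E u)"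
  by (simp add: Ad_vee_def[of "D ** E"] Ad_vee_def[of D] Ad_mult wedge_Ad_vee)

lemma Ad_vee_mat_1: "Ad_vee (mat 1) u = u"
  by (simp add: Ad_vee_def Ad_mat_1 vee_wedge)

lemma Ad_vee_inv_cancel: "D \<in> SE23 \<Longrightarrow> Ad_vee (matrix_inv D) (Ad_vee D u) = u"
  by (simp add: SE23_inv SE23_left_inv Ad_vee_mat_1 flip: Ad_vee_mult)

lemma se23_add: "\<eta> \<in> se23 \<Longrightarrow> \<zeta> \<in> se23 \<Longrightarrow> \<eta> + \<zeta> \<in> se23"
  by (auto simp: se23_eq_range_wedge linear_add[OF linear_wedge, symmetric])

lemma se23_uminus: "\<eta> \<in> se23 \<Longrightarrow> - \<eta> \<in> se23"
  by (auto simp: se23_eq_range_wedge linear_neg[OF linear_wedge, symmetric])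

lemma zero_in_se23: "0 \<in> se23"
  using linear_0[OF linear_wedge] wedge_in_se23 by metis

text \<open>This carries the algebra component of the group product over to vectors. Membership in
  \<open>se23\<close> matters, since \<open>vee\<close> is known to be additive only there.\<close>

lemma vee_add_Ad:
  assumes "D \<in> SE23" "\<eta> \<in> se23" "\<zeta> \<in> se23"
  shows "vee (\<eta> + Ad D \<zeta>) = vee \<eta> + Ad_vee D (vee \<zeta>)"
proof -
  have "Ad_vee D (vee \<zeta>) = vee (Ad D \<zeta>)"
    using assms by (simp add: Ad_vee_def wedge_vee)
  then show ?thesis
    using assms by (simp add: vee_eq_vee_lin Ad_in_se23 se23_add linear_add[OF linear_vee_lin])
qed

lemma group_TG: "group TG"
proof (rule groupI)
  fix x y assume "x \<in> carrier TG" "y \<in> carrier TG"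
  then show "x \<otimes>\<^bsub>TG\<^esub> y \<in> carrier TG"
    by (auto simp: TG_def SE23_mult se23_add Ad_in_se23)
next
  show "\<one>\<^bsub>TG\<^esub> \<in> carrier TG"
    by (simp add: TG_def mat_1_in_SE23 zero_in_se23)
next
  fix x y z assume "x \<in> carrier TG" "y \<in> carrier TG" "z \<in> carrier TG"
  then show "x \<otimes>\<^bsub>TG\<^esub> y \<otimes>\<^bsub>TG\<^esub> z = x \<otimes>\<^bsub>TG\<^esub> (y \<otimes>\<^bsub>TG\<^esub> z)"
    by (auto simp: TG_def matrix_mul_assoc Ad_mult linear_add[OF linear_Ad])
next
  fix x assume "x \<in> carrier TG"
  then show "\<one>\<^bsub>TG\<^esub> \<otimes>\<^bsub>TG\<^esub> x = x"
    by (auto simp: TG_def Ad_mat_1)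
next
  fix x assume "x \<in> carrier TG"
  then obtain D \<delta> where x: "x = (D, \<delta>)" "D \<in> SE23" "\<delta> \<in> se23"
    by (auto simp: TG_def)
  then show "\<exists>y\<in>carrier TG. y \<otimes>\<^bsub>TG\<^esub> x = \<one>\<^bsub>TG\<^esub>"
    \<comment> \<open>A left inverse suffices for \<open>groupI\<close>; its second component is the
      solution \<open>y\<close> of \<open>y + Ad (matrix_inv D) \<delta> = 0\<close>.\<close>
    by (intro bexI[of _ "(matrix_inv D, - Ad (matrix_inv D) \<delta>)"])
      (auto simp: TG_def SE23_inv SE23_left_inv se23_uminus Ad_in_se23)
qed


section \<open>The action\<close>

text \<open>The last two rows of an element of \<open>se23\<close> vanish, so only the rotational block of the
  inverse contributes to the product, and this block is linear in \<open>D\<close>.\<close>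

lemma inv_mult_se23:
  assumes "D \<in> SE23" "\<eta> \<in> se23"
  shows "matrix_inv D ** \<eta> = block (mat 1) 0 0 0 ** transpose D ** block (mat 1) 0 0 0 ** \<eta>"
proof -
  obtain A a b where D: "D = block A a b 1" "rotation_matrix A"
    using assms(1) by (auto simp: SE23_def)
  \<comment> \<open>\<open>block (mat 1) 0 0 0\<close> projects onto the first three coordinates.
    Applied on both sides, it removes the translations that transposition moved to the bottom rows,
    and the two unit diagonal entries.\<close>
  have "block (mat 1) 0 0 0 ** transpose D ** block (mat 1) 0 0 0 = block (transpose A) 0 0 0"
    by (simp add: D vec_eq_iff forall_5 sum_5 block_def matrix_matrix_mult_def transpose_def mat_def)
  then show ?thesis
    using assms(2) D by (auto simp: se23_def block_inverse block_mult)
qed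

text \<open>One extension \<open>F\<close>, defined on the whole ambient space, serves at every
  point, so \<open>U\<close> is always \<open>UNIV\<close>.\<close>

lemma smooth_phi: "smooth_map (carrier TG \<times> state_space) state_space phi"
proof -
  define P :: "real^5^5" where "P = block (mat 1) 0 0 0"
  \<comment> \<open>\<open>F\<close> avoids inversion: the left factor \<open>matrix_inv D\<close>
    becomes \<open>P ** transpose D ** P\<close>, the right factor is \<open>D\<close> as the
    inverse of an inverse, and \<open>vee\<close> becomes \<open>vee_lin\<close>.\<close>
  define F :: "((real^5^5) \<times> (real^5^5)) \<times> ((real^5^5) \<times> (real^9)) \<Rightarrow> (real^5^5) \<times> (real^9)"
    where "F p = (fst (snd p) ** fst (fst p),
      vee_lin (P ** transpose (fst (fst p)) ** P ** wedge (snd (snd p) - vee_lin (snd (fst p))) ** fst (fst p)))" for p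
  have lin: "linear (\<lambda>p::((real^5^5) \<times> (real^5^5)) \<times> ((real^5^5) \<times> (real^9)). fst (fst p))" "linear (\<lambda>p::((real^5^5) \<times> (real^5^5)) \<times> ((real^5^5) \<times> (real^9)). fst (snd p))"
    "linear (\<lambda>p::((real^5^5) \<times> (real^5^5)) \<times> ((real^5^5) \<times> (real^9)). wedge (snd (snd p) - vee_lin (snd (fst p))))"
    by (auto intro!: linearI simp: linear_add[OF linear_wedge] linear_scale[OF linear_wedge] linear_diff[OF linear_wedge]
        linear_add[OF linear_vee_lin] linear_scale[OF linear_vee_lin] algebra_simps)
  have "Ck_on k F UNIV" for k
    unfolding F_def[abs_def]
    by (intro Ck_on_Pair Ck_on_linear_compose[OF _ linear_vee_lin]
        Ck_on_linear_compose[OF _ linear_transpose]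
        Ck_on_bilinear[OF _ bilinear_matrix_mult] Ck_on_const Ck_on_linear lin open_UNIV)
  moreover have "F p = phi p" if "p \<in> carrier TG \<times> state_space" for p
  proof -
    obtain D \<delta> T b where p: "p = ((D, \<delta>), (T, b))" "D \<in> SE23" "\<delta> \<in> se23"
      using \<open>p \<in> carrier TG \<times> state_space\<close> by (auto simp: TG_def)
    have "Ad (matrix_inv D) (wedge u) =
        P ** transpose D ** P ** wedge u ** D" for u
      using p by (simp add: P_def Ad_def SE23_inv_inv inv_mult_se23 wedge_in_se23)
    moreover have "vee (Ad (matrix_inv D) (wedge u)) = vee_lin (Ad (matrix_inv D) (wedge u))" for u
      using p by (simp add: vee_eq_vee_lin Ad_in_se23 SE23_inv wedge_in_se23)
    ultimately show ?thesis
      using p by (simp add: F_def phi_def Ad_vee_def vee_eq_vee_lin)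
  qed
  moreover have "phi ` (carrier TG \<times> state_space) \<subseteq> state_space"
    by (auto simp: TG_def state_space_def phi_def SE23_mult)
  ultimately show ?thesis
    unfolding smooth_map_def by (metis IntD1 UNIV_I open_UNIV)
qed

theorem lemma5p5p1:
  shows "right_group_action TG state_space phi \<and> transitive_action TG state_space phi"
proof
  have "phi (\<one>\<^bsub>TG\<^esub>, p) = p" for p
    \<comment> \<open>Reading the zero matrix as \<open>wedge 0\<close> gives
      \<open>vee 0 = 0\<close>.\<close>
    using linear_0[OF linear_wedge] vee_wedge[of 0]
    by (cases p) (simp add: TG_def phi_def matrix_inv_eqI Ad_vee_mat_1)
  moreover have "phi (x, phi (y, p)) = phi (y \<otimes>\<^bsub>TG\<^esub> x, p)"
    if xy: "x \<in> carrier TG" "y \<in> carrier TG" for x y p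
  proof -
    obtain D \<delta> E \<epsilon> T b where *: "x = (D, \<delta>)" "y = (E, \<epsilon>)" "p = (T, b)"
      "D \<in> SE23" "E \<in> SE23" "\<delta> \<in> se23" "\<epsilon> \<in> se23"
      using xy by (cases p) (auto simp: TG_def)
    \<comment> \<open>Inversion reverses \<open>E ** D\<close>, so
      \<open>Ad_vee (matrix_inv E)\<close> acts first and can cancel the \<open>Ad_vee E\<close>
      coming from the group product.\<close>
    have "Ad_vee (matrix_inv (E ** D)) (b - vee (\<epsilon> + Ad E \<delta>)) =
        Ad_vee (matrix_inv D) (Ad_vee (matrix_inv E) ((b - vee \<epsilon>) - Ad_vee E (vee \<delta>)))"
      using * by (simp add: vee_add_Ad SE23_inv_mult Ad_vee_mult SE23_inv algebra_simps)
    also have "\<dots> = Ad_vee (matrix_inv D) (Ad_vee (matrix_inv E) (b - vee \<epsilon>) - vee \<delta>)"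
      using * by (simp add: linear_diff[OF linear_Ad_vee[OF SE23_inv], of E] Ad_vee_inv_cancel)
    finally show ?thesis
      using * by (simp add: TG_def phi_def matrix_mul_assoc)
  qed
  ultimately show "right_group_action TG state_space phi"
    by (simp add: right_group_action_def group_TG smooth_phi)
next
  have "\<exists>z\<in>carrier TG. phi (z, (T, b)) = (T', b')" if "T \<in> SE23" "T' \<in> SE23" for T T' b b'
  proof
    let ?D = "matrix_inv T ** T'"
    have D: "?D \<in> SE23"
      using that by (simp add: SE23_inv SE23_mult)
    then show "(?D, wedge (b - Ad_vee ?D b')) \<in> carrier TG"
      by (simp add: TG_def wedge_in_se23)
    show "phi ((?D, wedge (b - Ad_vee ?D b')), (T, b)) = (T', b')"
      using D that by (simp add: phi_def vee_wedge Ad_vee_inv_cancel matrix_mul_assoc SE23_right_inv)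
  qed
  then show "transitive_action TG state_space phi"
    by (auto simp: transitive_action_def state_space_def)
qed

end
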